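(* Let $d\in\mathbb{N}$ and $b\in\mathbb{R}^d$. The Active Set Algorithm (described in the context), run on input $(d,b)$, terminates after finitely many steps, and its output $x^\ast\in\mathbb{R}^d$ is the global optimal solution of $$\min_{x\in\mathbb{R}^d}\ \tfrac12 x^\top Q_d x+b^\top x\quad\text{subject to } x\le \mathbf{0}_d .$$
   Context: $\mathbb{N}$ is the set of positive integers. For $m\ge 1$, $Q_m:=2\mathrm{I}_m+2\mathrm{J}_m\in\mathbb{R}^{m\times m}$, where $\mathrm{I}_m$ is the identity matrix and $\mathrm{J}_m$ is the all-ones matrix; $Q_m$ is symmetric positive definite. Vector inequalities are entrywise. For $F\subseteq\{1,\dots,d\}$, $b_F\in\mathbb{R}^{|F|}$ is the subvector of $b$ with indices in $F$; vectors in $\mathbb{R}^{|F|}$ are indexed by the elements of $F$. If $F=\emptyset$, then $-Q_{|F|}^{-1}b_F$ is the empty vector. Active Set Algorithm (input $d,b$): 1. Set $x^\ast:=\mathbf{0}_d$, $B_1:=\emptyset$, $F_0:=\emptyset$, $F_1:=\{1,\dots,d\}$, $k:=1$. 2. While $|F_{k-1}|\ne|F_k|$: set $y:=-Q_{|F_k|}^{-1}b_{F_k}$ (indexed by $F_k$); set $F_{k+1}:=F_k\setminus\{i\in F_k: y_i>0\}$ and $B_{k+1}:=B_k\cup\{i\in F_k:y_i>0\}$; replace $k$ by $k+1$. 3. When the loop ends, set $x^\ast_{F_k}:=y$ (the last computed $y$) and output $x^\ast$ (the other entries remain $0$). *)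

theory Defs
  imports
    "HOL-Library.While_Combinator"
    "Jordan_Normal_Form.Gauss_Jordan_Elimination"
    "Jordan_Normal_Form.DL_Missing_Sublist"
begin

definition Q_mat :: "nat \<Rightarrow> real mat" where
  "Q_mat m = 2 \<cdot>\<^sub>m 1\<^sub>m m + 2 \<cdot>\<^sub>m mat m m (\<lambda>_. 1)"

(* Library vectors are indexed from 0, so F ranges over subsets of {..<d}. An F-indexed vector
   is stored as a vector of dimension card F whose j-th entry belongs to the j-th smallest
   element of F (pick F j); conversely i \<in> F sits at position card {a \<in> F. a < i}. *)

definition subvec :: "real vec \<Rightarrow> nat set \<Rightarrow> real vec" where
  "subvec b F = vec (card F) (\<lambda>j. b $ pick F j)"

definition entry_at :: "nat set \<Rightarrow> real vec \<Rightarrow> nat \<Rightarrow> real" where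
  "entry_at F y i = y $ card {a \<in> F. a < i}"

definition assign_at :: "real vec \<Rightarrow> nat set \<Rightarrow> real vec \<Rightarrow> real vec" where
  "assign_at x F y = vec (dim_vec x) (\<lambda>i. if i \<in> F then entry_at F y i else x $ i)"

(* The loop variables at iteration k: F_(k-1), F_k, B_k and the last computed y. *)

record state =
  F_prev :: "nat set"
  F_cur :: "nat set"
  B_cur :: "nat set"
  y_last :: "real vec"

(* y_last has no value before the first iteration; 0\<^sub>v 0 is a dummy, and for d \<ge> 1 it is
   never read because the loop body runs at least once. *)

definition init_state :: "nat \<Rightarrow> state" where
  "init_state d = \<lparr>F_prev = {}, F_cur = {..<d}, B_cur = {}, y_last = 0\<^sub>v 0\<rparr>"

definition loop_cond :: "state \<Rightarrow> bool" where
  "loop_cond s \<longleftrightarrow> card (F_prev s) \<noteq> card (F_cur s)"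

(* Q_mat m is invertible for every m (for m = 0 it is the empty matrix), so mat_inverse
   returns Some of the inverse here. *)

definition loop_body :: "real vec \<Rightarrow> state \<Rightarrow> state" where
  "loop_body b s =
    (let F = F_cur s;
         y = - (the (mat_inverse (Q_mat (card F))) *\<^sub>v subvec b F);
         P = {i \<in> F. entry_at F y i > 0}
     in \<lparr>F_prev = F, F_cur = F - P, B_cur = B_cur s \<union> P, y_last = y\<rparr>)"

(* None means that the loop does not terminate. *)

definition active_set_algorithm :: "nat \<Rightarrow> real vec \<Rightarrow> real vec option" where
  "active_set_algorithm d b =
    map_option (\<lambda>s. assign_at (0\<^sub>v d) (F_cur s) (y_last s))
      (while_option loop_cond (loop_body b) (init_state d))"

definition qp_objective :: "nat \<Rightarrow> real vec \<Rightarrow> real vec \<Rightarrow> real" where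
  "qp_objective d b x = 1 / 2 * (x \<bullet> (Q_mat d *\<^sub>v x)) + b \<bullet> x"

definition qp_feasible :: "nat \<Rightarrow> real vec \<Rightarrow> bool" where
  "qp_feasible d x \<longleftrightarrow> x \<in> carrier_vec d \<and> x \<le> 0\<^sub>v d"

end

theory Submission
  imports Defs "Jordan_Normal_Form.Determinant"
begin

text \<open>Since \<open>Q\<^sub>m\<^sup>-\<^sup>1 = (I - J / (m + 1)) / 2\<close>, the vector computed from \<open>F\<close> has the
  entries \<open>(\<tau> - b\<^sub>i) / 2\<close>, where \<open>\<tau>\<close> is the sum of \<open>b\<close> over \<open>F\<close> divided by \<open>|F| + 1\<close>. An iteration
  thus discards the indices with \<open>b\<^sub>i < \<tau>\<close>, which does not decrease \<open>\<tau>\<close>; hence every index ever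
  discarded satisfies \<open>b\<^sub>i < \<tau>\<close> for the current \<open>\<tau>\<close>. When nothing more is discarded, this inequality
  is the sign condition on the gradient outside \<open>F\<close>, and the gradient vanishes on \<open>F\<close>, so that the
  output is a KKT point of a strictly convex problem.\<close>

section \<open>The inverse of the matrix Q\<close>

definition Q_inv :: "nat \<Rightarrow> real mat" where
  "Q_inv m = mat m m (\<lambda>(i, j). (if i = j then 1 / 2 else 0) - 1 / (2 * (real m + 1)))"

lemma Q_mat_carrier [simp]: "Q_mat m \<in> carrier_mat m m"
  by (simp add: Q_mat_def)

lemma Q_inv_carrier [simp]: "Q_inv m \<in> carrier_mat m m"
  by (simp add: Q_inv_def)

lemma Q_mat_index: "i < m \<Longrightarrow> j < m \<Longrightarrow> Q_mat m $$ (i, j) = (if i = j then 2 else 0) + 2"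
  by (simp add: Q_mat_def)

lemma Q_mat_times_Q_inv: "Q_mat m * Q_inv m = 1\<^sub>m m"
proof (rule eq_matI)
  fix i j assume "i < dim_row (1\<^sub>m m :: real mat)" "j < dim_col (1\<^sub>m m :: real mat)"
  then have ij: "i < m" "j < m" by auto
  define c where "c = 1 / (2 * (real m + 1))"
  have "(Q_mat m * Q_inv m) $$ (i, j) = (\<Sum>k<m. Q_mat m $$ (i, k) * Q_inv m $$ (k, j))"
    using ij carrier_matD[OF Q_mat_carrier[of m]] carrier_matD[OF Q_inv_carrier[of m]]
    by (simp add: scalar_prod_def atLeast0LessThan)
  \<comment> \<open>The summand is the product of \<open>2 * [i = k] + 2\<close> and
    \<open>[k = j] / 2 - c\<close>, multiplied out and grouped by the brackets, so that each bracket
    picks a single index of the sum.\<close>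
  also have "\<dots> = (\<Sum>k<m. (if k = i then (if i = j then 1 else 0) - 2 * c else 0)
                       + (if k = j then 1 else 0) - 2 * c)"
    using ij by (intro sum.cong) (auto simp: Q_mat_index Q_inv_def c_def algebra_simps)
  also have "\<dots> = (if i = j then 1 else 0) - 2 * c + 1 - real m * (2 * c)"
    using ij by (simp add: sum.distrib sum_subtractf)
  \<comment> \<open>Apart from the diagonal term, \<open>1 - 2 * c * (m + 1)\<close> is left, which
    is zero by the choice of \<open>c\<close>.\<close>
  also have "\<dots> = (if i = j then 1 else 0)"
  proof -
    have "2 * c * (real m + 1) = 1" by (simp add: c_def)
    then show ?thesis by (simp add: algebra_simps)
  qed
  finally show "(Q_mat m * Q_inv m) $$ (i, j) = 1\<^sub>m m $$ (i, j)"
    using ij by simp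
qed (auto simp: carrier_matD[OF Q_mat_carrier] carrier_matD[OF Q_inv_carrier])

text \<open>For square matrices a right inverse is also a left inverse, so the matrix is a unit and
  \<open>None\<close> is impossible; a result \<open>Some B\<close> is \<open>Q_inv m\<close> by
  uniqueness of inverses.\<close>

lemma mat_inverse_Q_mat: "mat_inverse (Q_mat m) = Some (Q_inv m)"
proof (cases "mat_inverse (Q_mat m)")
  case None
  have "Q_inv m * Q_mat m = 1\<^sub>m m"
    using mat_mult_left_right_inverse[OF Q_mat_carrier Q_inv_carrier Q_mat_times_Q_inv] .
  then have "Q_mat m \<in> Units (ring_mat TYPE(real) m ())"
    using Q_mat_times_Q_inv[of m] unfolding Units_def ring_mat_def
    by (auto intro!: bexI[of _ "Q_inv m"])
  with mat_inverse(1)[OF Q_mat_carrier None, of "()"] show ?thesis by blast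
next
  case (Some B)
  from mat_inverse(2)[OF Q_mat_carrier Some]
  have B: "B * Q_mat m = 1\<^sub>m m" "B \<in> carrier_mat m m" by auto
  have "B = B * (Q_mat m * Q_inv m)"
    using B(2) by (simp add: Q_mat_times_Q_inv)
  also have "\<dots> = B * Q_mat m * Q_inv m"
    by (rule assoc_mult_mat[OF B(2) Q_mat_carrier Q_inv_carrier, symmetric])
  also have "\<dots> = Q_inv m"
    by (simp add: B(1) left_mult_one_mat[OF Q_inv_carrier])
  finally show ?thesis using Some by simp
qed

section \<open>The vector computed in one iteration\<close>

lemma bij_betw_pick: "finite F \<Longrightarrow> bij_betw (pick F) {..<card F} F"
proof (rule bij_betwI[where g = "\<lambda>i. card {a \<in> F. a < i}"])
  assume F: "finite F"
  show "pick F \<in> {..<card F} \<rightarrow> F" by (auto intro: pick_in_set_le)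
  show "(\<lambda>i. card {a \<in> F. a < i}) \<in> F \<rightarrow> {..<card F}"
    using F by (auto intro!: psubset_card_mono)
  show "card {a \<in> F. a < pick F j} = j" if "j \<in> {..<card F}" for j
    using that card_pick_le[of j F] by simp
  show "pick F (card {a \<in> F. a < i}) = i" if "i \<in> F" for i
    using that by (rule pick_card_in_set)
qed

text \<open>This is -2 times the sum of the entries of the vector computed from \<open>F\<close>, so
  it is what the rank-one part of Q contributes to the gradient, with opposite sign.\<close>

definition threshold :: "real vec \<Rightarrow> nat set \<Rightarrow> real" where
  "threshold b F = (\<Sum>i\<in>F. b $ i) / (real (card F) + 1)"

text \<open>Index \<open>i\<close> is stored at position \<open>k\<close>. In row \<open>k\<close>
  of the inverse, the diagonal 1/2 contributes half of \<open>b $ i\<close>, and the constant part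
  contributes the sum of \<open>b\<close> over all of \<open>F\<close>, reindexed along
  \<open>pick F\<close>.\<close>

lemma entry_at_solution:
  assumes F: "finite F" and i: "i \<in> F"
  shows "entry_at F (- (the (mat_inverse (Q_mat (card F))) *\<^sub>v subvec b F)) i
           = (threshold b F - b $ i) / 2"
proof -
  define m where "m = card F"
  define k where "k = card {a \<in> F. a < i}"
  have k: "k < m" "pick F k = i"
    using assms by (auto simp: k_def m_def pick_card_in_set intro!: psubset_card_mono)
  have "(Q_inv m *\<^sub>v subvec b F) $ k = (\<Sum>j<m. Q_inv m $$ (k, j) * b $ pick F j)"
    using k(1) by (simp add: Q_inv_def subvec_def m_def scalar_prod_def atLeast0LessThan)
  also have "\<dots> = (\<Sum>j<m. (if j = k then b $ i / 2 else 0)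
                       - b $ pick F j / (2 * (real m + 1)))"
    using k by (intro sum.cong) (auto simp: Q_inv_def algebra_simps)
  also have "\<dots> = b $ i / 2 - (\<Sum>j<m. b $ pick F j) / (2 * (real m + 1))"
    using k(1) by (simp add: sum_subtractf sum_divide_distrib)
  also have "(\<Sum>j<m. b $ pick F j) = (\<Sum>j\<in>F. b $ j)"
    unfolding m_def by (rule sum.reindex_bij_betw[OF bij_betw_pick[OF F]])
  finally have "(Q_inv m *\<^sub>v subvec b F) $ k = (b $ i - threshold b F) / 2"
    by (simp add: threshold_def m_def field_simps)
  then show ?thesis
    using k(1) by (simp add: entry_at_def mat_inverse_Q_mat Q_inv_def field_simps flip: m_def k_def)
qed

section \<open>Loop invariant and termination\<close>

text \<open>The sum over \<open>F\<close> is \<open>t * (card F + 1)\<close>. The discarded indices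
  take away at most \<open>t\<close> each, so at least \<open>t * (card G + 1)\<close> remains for
  the kept set \<open>G\<close>.\<close>

lemma threshold_mono_discard:
  assumes F: "finite F"
  shows "threshold b F \<le> threshold b {i \<in> F. threshold b F \<le> b $ i}"
proof -
  define t where "t = threshold b F"
  define G where "G = {i \<in> F. t \<le> b $ i}"
  have fin: "finite G" "G \<subseteq> F" using F by (auto simp: G_def)
  have "(\<Sum>i\<in>F. b $ i) = (\<Sum>i\<in>F - G. b $ i) + (\<Sum>i\<in>G. b $ i)"
    using F fin by (simp add: sum.subset_diff)
  moreover have "(\<Sum>i\<in>F - G. b $ i) \<le> (\<Sum>i\<in>F - G. t)"
    by (rule sum_mono) (auto simp: G_def)
  moreover have "(\<Sum>i\<in>F - G. t) = (real (card F) - real (card G)) * t"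
    using F fin by (simp add: card_Diff_subset card_mono of_nat_diff)
  moreover have "(\<Sum>i\<in>F. b $ i) = t * (real (card F) + 1)"
    by (simp add: t_def threshold_def)
  ultimately have "t * (real (card G) + 1) \<le> (\<Sum>i\<in>G. b $ i)"
    by (simp add: algebra_simps)
  then show ?thesis
    by (simp add: threshold_def[of b G] pos_le_divide_eq flip: t_def G_def)
qed

text \<open>The disjunction separates the initial state, whose \<open>y_last\<close> is a dummy,
  from states after an iteration, where \<open>y_last\<close> is indexed along
  \<open>F_prev\<close>, the set it was computed from.\<close>

definition loop_inv :: "nat \<Rightarrow> real vec \<Rightarrow> state \<Rightarrow> bool" where
  "loop_inv d b s \<longleftrightarrow>
     F_cur s \<subseteq> {..<d} \<and>
     (\<forall>i<d. i \<notin> F_cur s \<longrightarrow> b $ i < threshold b (F_cur s)) \<and>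
     (F_prev s = {} \<and> F_cur s = {..<d} \<or>
      F_prev s \<subseteq> {..<d} \<and>
      F_cur s = {i \<in> F_prev s. threshold b (F_prev s) \<le> b $ i} \<and>
      (\<forall>i\<in>F_prev s. entry_at (F_prev s) (y_last s) i = (threshold b (F_prev s) - b $ i) / 2))"

lemma loop_body_fields:
  assumes "finite (F_cur s)"
  shows "F_prev (loop_body b s) = F_cur s"
    and "F_cur (loop_body b s) = {i \<in> F_cur s. threshold b (F_cur s) \<le> b $ i}"
    and "\<forall>i\<in>F_cur s. entry_at (F_cur s) (y_last (loop_body b s)) i
           = (threshold b (F_cur s) - b $ i) / 2"
  by (auto simp: loop_body_def Let_def entry_at_solution[OF assms])

lemma loop_body_inv:
  assumes "loop_inv d b s"
  shows "loop_inv d b (loop_body b s)"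
proof -
  have cur: "F_cur s \<subseteq> {..<d}" and out: "\<And>i. i < d \<Longrightarrow> i \<notin> F_cur s \<Longrightarrow> b $ i < threshold b (F_cur s)"
    using assms by (auto simp: loop_inv_def)
  have fin: "finite (F_cur s)" using cur finite_subset by blast
  \<comment> \<open>Whether \<open>i\<close> was discarded earlier or just now, \<open>b $ i\<close>
    lies below the old threshold, which is at most the new one.\<close>
  have "b $ i < threshold b (F_cur (loop_body b s))" if "i < d" "i \<notin> F_cur (loop_body b s)" for i
    using that out[of i] threshold_mono_discard[OF fin, of b]
    by (fastforce simp: loop_body_fields(2)[OF fin])
  then show ?thesis
    using cur by (auto simp: loop_inv_def loop_body_fields[OF fin])
qed

text \<open>The cardinality of \<open>F_cur\<close> alone is not a strict measure, since the last
  iteration discards nothing. That iteration makes the loop condition false, so adding the truth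
  value of the condition gives a strict decrease.\<close>

lemma loop_terminates:
  "\<exists>s. while_option loop_cond (loop_body b) (init_state d) = Some s
     \<and> loop_inv d b s \<and> \<not> loop_cond s"
proof -
  have init: "loop_inv d b (init_state d)"
    by (simp add: loop_inv_def init_state_def)
  have step: "loop_inv d b (loop_body b s) \<and>
      card (F_cur (loop_body b s)) + of_bool (loop_cond (loop_body b s))
        < card (F_cur s) + of_bool (loop_cond s)"
    if inv: "loop_inv d b s" and cond: "loop_cond s" for s
  proof -
    have fin: "finite (F_cur s)"
      using inv finite_subset by (auto simp: loop_inv_def)
    have "card (F_cur (loop_body b s)) \<le> card (F_cur s)"
      using fin by (auto simp: loop_body_fields(2)[OF fin] intro: card_mono)
    then show ?thesis
      using loop_body_inv[OF inv] cond
      by (auto simp: loop_cond_def loop_body_fields(1)[OF fin])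
  qed
  have "\<exists>s. while_option loop_cond (loop_body b) (init_state d) = Some s"
    by (rule measure_while_option_Some[where P = "loop_inv d b"
          and f = "\<lambda>s. card (F_cur s) + of_bool (loop_cond s)", OF step init])
  then obtain s where s: "while_option loop_cond (loop_body b) (init_state d) = Some s"
    by blast
  have "loop_inv d b s"
    using while_option_rule[OF _ s, of "loop_inv d b"] step init by blast
  with s while_option_stop[OF s] show ?thesis by blast
qed

section \<open>The objective and its KKT points\<close>

lemma qp_objective_eq:
  assumes "b \<in> carrier_vec d" "x \<in> carrier_vec d"
  shows "qp_objective d b x = (\<Sum>i<d. (x $ i)\<^sup>2) + (\<Sum>i<d. x $ i)\<^sup>2 + (\<Sum>i<d. b $ i * x $ i)"
proof -
  have Qx: "(Q_mat d *\<^sub>v x) $ i = 2 * x $ i + 2 * (\<Sum>j<d. x $ j)" if "i < d" for i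
  proof -
    have "(Q_mat d *\<^sub>v x) $ i = (\<Sum>j<d. Q_mat d $$ (i, j) * x $ j)"
      using that assms(2) carrier_matD[OF Q_mat_carrier[of d]]
      by (simp add: scalar_prod_def atLeast0LessThan)
    also have "\<dots> = (\<Sum>j<d. (if j = i then 2 * x $ i else 0) + 2 * x $ j)"
      using that by (intro sum.cong) (auto simp: Q_mat_index)
    also have "\<dots> = 2 * x $ i + 2 * (\<Sum>j<d. x $ j)"
      using that by (simp add: sum.distrib sum_distrib_left)
    finally show ?thesis .
  qed
  have "x \<bullet> (Q_mat d *\<^sub>v x) = (\<Sum>i<d. x $ i * (Q_mat d *\<^sub>v x) $ i)"
    using carrier_matD[OF Q_mat_carrier[of d]] by (simp add: scalar_prod_def atLeast0LessThan)
  also have "\<dots> = (\<Sum>i<d. 2 * (x $ i)\<^sup>2 + 2 * (x $ i * (\<Sum>j<d. x $ j)))"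
    by (intro sum.cong) (auto simp: Qx algebra_simps power2_eq_square)
  also have "\<dots> = 2 * (\<Sum>i<d. (x $ i)\<^sup>2) + 2 * (\<Sum>i<d. x $ i)\<^sup>2"
    by (simp add: sum.distrib sum_distrib_left[symmetric] sum_distrib_right[symmetric]
        power2_eq_square)
  finally show ?thesis
    using assms by (simp add: qp_objective_def scalar_prod_def atLeast0LessThan)
qed

text \<open>The exact second-order Taylor expansion at \<open>x\<close>: the first sum pairs the
  gradient with the displacement, and the two squared terms are the quadratic form of Q on the
  displacement, halved.\<close>

lemma qp_objective_expand:
  assumes "b \<in> carrier_vec d" "x \<in> carrier_vec d" "z \<in> carrier_vec d"
  shows "qp_objective d b z = qp_objective d b x
    + (\<Sum>i<d. (2 * x $ i + 2 * (\<Sum>j<d. x $ j) + b $ i) * (z $ i - x $ i))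
    + (\<Sum>i<d. (z $ i - x $ i)\<^sup>2) + (\<Sum>i<d. z $ i - x $ i)\<^sup>2"
proof -
  define S where "S = (\<Sum>i<d. x $ i)"
  define D where "D = (\<Sum>i<d. z $ i - x $ i)"
  have Z: "(\<Sum>i<d. z $ i) = S + D" by (simp add: S_def D_def sum_subtractf)
  \<comment> \<open>The squared total is left out here. Its cross term \<open>2 * S * D\<close> is
    nevertheless contained in the gradient sum, hence the subtraction in each summand.\<close>
  have "(\<Sum>i<d. (z $ i)\<^sup>2) + (\<Sum>i<d. b $ i * z $ i)
      = (\<Sum>i<d. (x $ i)\<^sup>2 + b $ i * x $ i
          + (2 * x $ i + 2 * S + b $ i) * (z $ i - x $ i)
          + (z $ i - x $ i)\<^sup>2 - 2 * S * (z $ i - x $ i))"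
    unfolding sum.distrib[symmetric]
    by (intro sum.cong) (auto simp: algebra_simps power2_eq_square)
  also have "\<dots> = (\<Sum>i<d. (x $ i)\<^sup>2) + (\<Sum>i<d. b $ i * x $ i)
      + (\<Sum>i<d. (2 * x $ i + 2 * S + b $ i) * (z $ i - x $ i))
      + (\<Sum>i<d. (z $ i - x $ i)\<^sup>2) - 2 * S * D"
    by (simp only: sum.distrib sum_subtractf[of "\<lambda>i. _ i + _ i"] sum_distrib_left[symmetric] D_def)
  finally show ?thesis
    using assms by (simp add: qp_objective_eq Z power2_sum flip: S_def D_def)
qed

text \<open>The linear term of the expansion is nonnegative for feasible \<open>z\<close>: where
  \<open>x $ i = 0\<close> both factors are \<le> 0, elsewhere the gradient vanishes. The objective
  thus grows at least by the squared distance from \<open>x\<close>, which yields minimality and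
  uniqueness together.\<close>

lemma kkt_unique_minimizer:
  assumes b: "b \<in> carrier_vec d" and x: "qp_feasible d x"
    and grad: "\<And>i. i < d \<Longrightarrow> 2 * x $ i + 2 * (\<Sum>j<d. x $ j) + b $ i \<le> 0"
    and slack: "\<And>i. i < d \<Longrightarrow> x $ i \<noteq> 0 \<Longrightarrow> 2 * x $ i + 2 * (\<Sum>j<d. x $ j) + b $ i = 0"
  shows "is_arg_min (qp_objective d b) (qp_feasible d) x"
    and "is_arg_min (qp_objective d b) (qp_feasible d) z \<Longrightarrow> z = x"
proof -
  have xc: "x \<in> carrier_vec d" using x by (simp add: qp_feasible_def)
  have growth: "qp_objective d b x + (\<Sum>i<d. (z $ i - x $ i)\<^sup>2) \<le> qp_objective d b z"
    if z: "qp_feasible d z" for z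
  proof -
    have zc: "z \<in> carrier_vec d" using z by (simp add: qp_feasible_def)
    have "0 \<le> (2 * x $ i + 2 * (\<Sum>j<d. x $ j) + b $ i) * (z $ i - x $ i)" if i: "i < d" for i
    proof (cases "x $ i = 0")
      case True
      have "z $ i \<le> 0" using z i by (auto simp: qp_feasible_def less_eq_vec_def)
      with True grad[OF i] show ?thesis by (simp add: mult_nonpos_nonpos)
    next
      case False
      with slack[OF i] show ?thesis by simp
    qed
    then have "0 \<le> (\<Sum>i<d. (2 * x $ i + 2 * (\<Sum>j<d. x $ j) + b $ i) * (z $ i - x $ i))"
      by (intro sum_nonneg) auto
    then show ?thesis
      using qp_objective_expand[OF b xc zc] by simp
  qed
  have sq: "0 \<le> (\<Sum>i<d. (z $ i - x $ i)\<^sup>2)" for z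
    by (simp add: sum_nonneg)
  show "is_arg_min (qp_objective d b) (qp_feasible d) x"
    unfolding is_arg_min_linorder using x growth sq by (smt (verit))
  assume z: "is_arg_min (qp_objective d b) (qp_feasible d) z"
  then have zf: "qp_feasible d z" and "qp_objective d b z \<le> qp_objective d b x"
    using x by (auto simp: is_arg_min_linorder)
  with growth[OF zf] sq[of z] have "(\<Sum>i<d. (z $ i - x $ i)\<^sup>2) = 0" by linarith
  then have "\<forall>i<d. z $ i = x $ i"
    by (simp add: sum_nonneg_eq_0_iff)
  then show "z = x"
    using xc zf by (auto simp: qp_feasible_def)
qed

section \<open>The output as a KKT point\<close>

theorem theorem3p5:
  fixes d :: nat and b :: "real vec"
  assumes "d \<ge> 1" and "b \<in> carrier_vec d"
  shows "\<exists>x. active_set_algorithm d b = Some x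
    \<and> x \<in> carrier_vec d
    \<and> is_arg_min (qp_objective d b) (qp_feasible d) x
    \<and> (\<forall>z. is_arg_min (qp_objective d b) (qp_feasible d) z \<longrightarrow> z = x)"
proof -
  obtain s where run: "while_option loop_cond (loop_body b) (init_state d) = Some s"
    and inv: "loop_inv d b s" and stop: "card (F_prev s) = card (F_cur s)"
    using loop_terminates[of b d] by (auto simp: loop_cond_def)
  define F where "F = F_cur s"
  define t where "t = threshold b F"
  define x where "x = assign_at (0\<^sub>v d) F (y_last s)"
  \<comment> \<open>For \<open>d \<ge> 1\<close> the initial state satisfies the loop condition, so
    at least one iteration has run and \<open>y_last\<close> is genuine.\<close>
  have "\<not> (F_prev s = {} \<and> F_cur s = {..<d})" using stop assms(1) by auto
  then have prev: "F_prev s \<subseteq> {..<d}"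
      "F_cur s = {i \<in> F_prev s. threshold b (F_prev s) \<le> b $ i}"
      "\<forall>i\<in>F_prev s. entry_at (F_prev s) (y_last s) i = (threshold b (F_prev s) - b $ i) / 2"
    using inv by (auto simp: loop_inv_def)
  \<comment> \<open>The loop test compares only cardinalities, but the sets are nested and hence
    equal. This lets the output step read \<open>y_last\<close> along \<open>F_cur\<close>.\<close>
  have "F_cur s = F_prev s"
    using prev(1,2) stop by (intro card_subset_eq) (auto intro: finite_subset)
  then have F: "F \<subseteq> {..<d}" "\<And>i. i \<in> F \<Longrightarrow> t \<le> b $ i"
      "\<And>i. i \<in> F \<Longrightarrow> entry_at F (y_last s) i = (t - b $ i) / 2"
    using prev by (auto simp: F_def t_def)
  have out: "b $ i < t" if "i < d" "i \<notin> F" for i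
    using inv that by (auto simp: loop_inv_def F_def t_def)
  have xc: "x \<in> carrier_vec d" by (simp add: x_def assign_at_def)
  have xi: "x $ i = (if i \<in> F then (t - b $ i) / 2 else 0)" if "i < d" for i
    using that F(3) by (simp add: x_def assign_at_def)
  have feas: "qp_feasible d x"
    using xc xi F(2) by (auto simp: qp_feasible_def less_eq_vec_def)
  have "(\<Sum>i<d. x $ i) = (\<Sum>i<d. if i \<in> F then (t - b $ i) / 2 else 0)"
    by (intro sum.cong) (auto simp: xi)
  also have "\<dots> = (\<Sum>i\<in>F. (t - b $ i) / 2)"
    using F(1) by (simp add: sum.If_cases Int_absorb1)
  also have "\<dots> = (real (card F) * t - (\<Sum>i\<in>F. b $ i)) / 2"
    by (simp add: sum_subtractf flip: sum_divide_distrib)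
  also have "(\<Sum>i\<in>F. b $ i) = t * (real (card F) + 1)"
    by (simp add: t_def threshold_def)
  \<comment> \<open>By this identity the gradient at \<open>i\<close> is
    \<open>2 * x $ i - t + b $ i\<close>, which is zero on \<open>F\<close> and
    \<open>b $ i - t\<close> off \<open>F\<close>.\<close>
  finally have S: "2 * (\<Sum>i<d. x $ i) = - t"
    by (simp add: algebra_simps)
  have grad: "2 * x $ i + 2 * (\<Sum>j<d. x $ j) + b $ i = (if i \<in> F then 0 else b $ i - t)"
    if "i < d" for i
    unfolding S xi[OF that] by (simp add: diff_divide_distrib)
  have "2 * x $ i + 2 * (\<Sum>j<d. x $ j) + b $ i \<le> 0" if "i < d" for i
    unfolding grad[OF that] using out[OF that] by auto
  moreover have "2 * x $ i + 2 * (\<Sum>j<d. x $ j) + b $ i = 0" if "i < d" "x $ i \<noteq> 0" for i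
    unfolding grad[OF that(1)] using that by (simp add: xi split: if_splits)
  ultimately have "is_arg_min (qp_objective d b) (qp_feasible d) x"
      "\<forall>z. is_arg_min (qp_objective d b) (qp_feasible d) z \<longrightarrow> z = x"
    using kkt_unique_minimizer[OF assms(2) feas] by blast+
  moreover have "active_set_algorithm d b = Some x"
    by (simp add: active_set_algorithm_def run x_def F_def)
  ultimately show ?thesis using xc by blast
qed

end
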